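(* Directed topological complexity is invariant under coherent directed homotopy equivalence: Let $\alpha\in\{+,-,0\}$ and let $X$ and $Y$ be d-spaces (whose underlying spaces are Euclidean Neighbourhood Retracts). If there exists a coherent $\alpha$-directed homotopy equivalence $f:X\to Y$, then $\overrightarrow{TC}(X,\vec{P}(X))=\overrightarrow{TC}(Y,\vec{P}(Y))$.
   Context: Let $I=[0,1]$. A d-space is a topological space $X$ together with a subspace $\vec{P}(X)\subset X^I$ (the d-paths) that contains the constant paths and is closed under concatenation and under non-decreasing continuous reparametrizations $p:I\to I$. A d-map $f:X\to Y$ between d-spaces is a continuous map with $f\circ p\in\vec{P}(Y)$ for all $p\in\vec{P}(X)$. $\vec{P}(X)_x^y$ is the subspace of d-paths from $x$ to $y$; $x\preceq y$ means $\vec{P}(X)_x^y\neq\emptyset$; $\vec{X^2}=\{(x,y)\in X^2\mid x\preceq y\}$. The trace space $\vec{T}(X)$ is the quotient of $\vec{P}(X)$ (quotient topology) under the equivalence relation generated by $p\sim p\circ\varphi$ for continuous non-decreasing $\varphi:I\to I$ with $\varphi(0)=0,\varphi(1)=1$; $\vec{T}(X)_x^y$ is the fibre over $(x,y)\in\vec{X^2}$ of the end-point map $\vec{e}_X:\vec{T}(X)\to\vec{X^2}$. A d-map $f:X\to Y$ induces $\vec{f^2}:\vec{X^2}\to\vec{Y^2}$, $(x_1,x_2)\mapsto(fx_1,fx_2)$, $\vec{T}(f):\vec{T}(X)\to\vec{T}(Y)$, $\sigma\mapsto f\circ\sigma$, and restrictions $\vec{T}(f)_{x_1}^{x_2}:\vec{T}(X)_{x_1}^{x_2}\to\vec{T}(Y)_{fx_1}^{fx_2}$.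 A d-map $f$ is path space preserving (psp) if $\vec{T}(f)_{x_1}^{x_2}$ is a weak homotopy equivalence for all $(x_1,x_2)\in\vec{X^2}$. Intervals: $I$ as a d-space is $[0,1]$ with only constant d-paths (neutral interval); $\vec{I}$ is $[0,1]$ with the non-decreasing paths as d-paths; products carry the product d-structure. A d-homotopy from $H_0$ to $H_1$ is a d-map $H:X\times\vec{I}\to X$; a neutral d-homotopy is a d-map $H:X\times I\to X$. Either is psp if every $H_t=H(-,t)$ is psp. It is coherently psp if it is psp and, moreover, the map $\bigsqcup_t\vec{T}(H_t):\vec{T}(X)\times I\to(\vec{H^2})^*\vec{T}(X)$ over $\vec{X^2}\times I$ has a continuous fibre homotopy inverse (over $\vec{X^2}\times I$), where $(\vec{H^2})^*\vec{T}(X)$ is the pullback of $\vec{e}_X$ along $\vec{H^2}:\vec{X^2}\times I\to\vec{X^2}$, $(x_1,x_2,t)\mapsto(H_tx_1,H_tx_2)$. A d-map $f:X\to X$ is coherently $\alpha$-inessential if there is a coherently psp homotopy $H$ which is: for $\alpha=+$, a d-homotopy with $H_0=id_X,H_1=f$; for $\alpha=-$, a d-homotopy with $H_0=f,H_1=id_X$; for $\alpha=0$, a neutral d-homotopy with $H_0=id_X,H_1=f$. A d-map $h:X\to X$ is coherently rather $\alpha$-inessential if there exists a coherently $\alpha$-inessential d-map $g:X\to X$ such that $h\circ g$ is coherently $\alpha$-inessential. A d-map $f:X\to Y$ is a coherent $\alpha$-directed homotopy equivalence if there exists a d-map $g:Y\to X$ such that $g\circ f$ and $f\circ g$ are coherently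 rather $\alpha$-inessential. Directed topological complexity: for a d-space $(X,\vec{P}(X))$ with $X$ a Euclidean Neighbourhood Retract, $\overrightarrow{TC}(X,\vec{P}(X))$ is the minimal number $n\in\mathbb{N}$ (if existing) such that there are a (not necessarily continuous) section $s$ of $\vec{e}_X:\vec{T}(X)\to\vec{X^2}$ and a decomposition $\vec{X^2}=\bigsqcup_{i=1}^nX_i$ into mutually disjoint subspaces $X_i\subseteq\vec{X^2}$ such that each restriction $s|_{X_i}$ is continuous. (The equality in the claim includes that one side exists if and only if the other does.) *)

theory Defs
  imports "HOL-Analysis.Analysis" "HOL-Library.Extended_Nat"
begin

section \<open>Topological preliminaries\<close>

abbreviation unit_interval :: "real topology"
  where "unit_interval \<equiv> top_of_set {0..1}"

definition compact_open_topology :: "'a topology \<Rightarrow> 'b topology \<Rightarrow> ('a \<Rightarrow> 'b) topology"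
  where "compact_open_topology A X =
    topology_generated_by
      {{f \<in> extensional (topspace A). continuous_map A X f \<and> f ` K \<subseteq> U} | K U.
        compactin A K \<and> openin X U}"

definition quotient_topology :: "'a topology \<Rightarrow> ('a \<Rightarrow> 'b) \<Rightarrow> 'b topology"
  where "quotient_topology X q =
    topology (\<lambda>U. U \<subseteq> q ` topspace X \<and> openin X {x \<in> topspace X. q x \<in> U})"

lemma openin_quotient_topology:
  "openin (quotient_topology X q) U \<longleftrightarrow>
    U \<subseteq> q ` topspace X \<and> openin X {x \<in> topspace X. q x \<in> U}"
proof -
  have "istopology (\<lambda>U. U \<subseteq> q ` topspace X \<and> openin X {x \<in> topspace X. q x \<in> U})"
    unfolding istopology_def
  proof (rule conjI; clarify)
    fix S T
    assume S: "S \<subseteq> q ` topspace X" "openin X {x \<in> topspace X. q x \<in> S}"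
      and T: "T \<subseteq> q ` topspace X" "openin X {x \<in> topspace X. q x \<in> T}"
    have "{x \<in> topspace X. q x \<in> S \<inter> T} =
        {x \<in> topspace X. q x \<in> S} \<inter> {x \<in> topspace X. q x \<in> T}" by auto
    with S T show "S \<inter> T \<subseteq> q ` topspace X \<and> openin X {x \<in> topspace X. q x \<in> S \<inter> T}"
      by (simp add: openin_Int le_infI1)
  next
    fix \<K>
    assume K: "\<forall>K\<in>\<K>. K \<subseteq> q ` topspace X \<and> openin X {x \<in> topspace X. q x \<in> K}"
    have "{x \<in> topspace X. q x \<in> \<Union>\<K>} = (\<Union>K\<in>\<K>. {x \<in> topspace X. q x \<in> K})" by auto
    with K show "\<Union>\<K> \<subseteq> q ` topspace X \<and> openin X {x \<in> topspace X. q x \<in> \<Union>\<K>}"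
      by (auto intro!: openin_Union)
  qed
  then show ?thesis
    by (simp add: quotient_topology_def topology_inverse')
qed

lemma quotient_map_quotient_topology: "quotient_map X (quotient_topology X q) q"
proof -
  have "topspace (quotient_topology X q) = q ` topspace X"
  proof
    show "topspace (quotient_topology X q) \<subseteq> q ` topspace X"
      using openin_topspace[of "quotient_topology X q"] unfolding openin_quotient_topology by blast
    have "{x \<in> topspace X. q x \<in> q ` topspace X} = topspace X" by auto
    then have "openin (quotient_topology X q) (q ` topspace X)"
      by (simp add: openin_quotient_topology)
    then show "q ` topspace X \<subseteq> topspace (quotient_topology X q)"
      by (rule openin_subset)
  qed
  then show ?thesis
    by (auto simp: quotient_map_def openin_quotient_topology)
qed

text \<open>Euclidean neighbourhood retracts as abstract spaces; the library's \<open>ENR\<close> is about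
  subsets of a fixed Euclidean space.\<close>

definition ENR_space :: "'a topology \<Rightarrow> bool"
  where "ENR_space X \<longleftrightarrow>
    (\<exists>n U S. openin (Euclidean_space n) U \<and>
             S retract_of_space (subtopology (Euclidean_space n) U) \<and>
             X homeomorphic_space (subtopology (Euclidean_space n) S))"

section \<open>Weak homotopy equivalences\<close>

definition cube :: "nat \<Rightarrow> (nat \<Rightarrow> real) topology"
  where "cube n = product_topology (\<lambda>_. unit_interval) {..<n}"

definition cube_boundary :: "nat \<Rightarrow> (nat \<Rightarrow> real) set"
  where "cube_boundary n = {x \<in> topspace (cube n). \<exists>i<n. x i = 0 \<or> x i = 1}"

definition based_cubes :: "nat \<Rightarrow> 'a topology \<Rightarrow> 'a \<Rightarrow> ((nat \<Rightarrow> real) \<Rightarrow> 'a) set"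
  where "based_cubes n X a =
    {u. continuous_map (cube n) X u \<and> u ` cube_boundary n \<subseteq> {a}}"

definition based_homotopy_rel ::
    "nat \<Rightarrow> 'a topology \<Rightarrow> 'a \<Rightarrow> (((nat \<Rightarrow> real) \<Rightarrow> 'a) \<times> ((nat \<Rightarrow> real) \<Rightarrow> 'a)) set"
  where "based_homotopy_rel n X a =
    {(u, v). u \<in> based_cubes n X a \<and> v \<in> based_cubes n X a \<and>
      homotopic_with (\<lambda>w. w ` cube_boundary n \<subseteq> {a}) (cube n) X u v}"

text \<open>The underlying set of the \<open>n\<close>-th homotopy group. The map induced by a continuous map is
  automatically a homomorphism, hence an isomorphism if and only if it is bijective; so the group
  operation is not needed below.\<close>

definition homotopy_group :: "nat \<Rightarrow> 'a topology \<Rightarrow> 'a \<Rightarrow> ((nat \<Rightarrow> real) \<Rightarrow> 'a) set set"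
  where "homotopy_group n X a = based_cubes n X a // based_homotopy_rel n X a"

definition homotopy_group_map ::
    "nat \<Rightarrow> 'b topology \<Rightarrow> ('a \<Rightarrow> 'b) \<Rightarrow> 'a \<Rightarrow> ((nat \<Rightarrow> real) \<Rightarrow> 'a) set \<Rightarrow> ((nat \<Rightarrow> real) \<Rightarrow> 'b) set"
  where "homotopy_group_map n Y f a c = based_homotopy_rel n Y (f a) `` ((\<lambda>u. f \<circ> u) ` c)"

definition path_components_map :: "'b topology \<Rightarrow> ('a \<Rightarrow> 'b) \<Rightarrow> 'a set \<Rightarrow> 'b set"
  where "path_components_map Y f C = (\<Union>x\<in>C. path_component_of_set Y (f x))"

definition weak_homotopy_equivalence :: "'a topology \<Rightarrow> 'b topology \<Rightarrow> ('a \<Rightarrow> 'b) \<Rightarrow> bool"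
  where "weak_homotopy_equivalence X Y f \<longleftrightarrow>
    continuous_map X Y f \<and>
    bij_betw (path_components_map Y f) (path_components_of X) (path_components_of Y) \<and>
    (\<forall>n\<ge>1. \<forall>a\<in>topspace X.
      bij_betw (homotopy_group_map n Y f a) (homotopy_group n X a) (homotopy_group n Y (f a)))"

section \<open>Fibre homotopy equivalences\<close>

definition fibre_map ::
    "'e topology \<Rightarrow> ('e \<Rightarrow> 'b) \<Rightarrow> 'f topology \<Rightarrow> ('f \<Rightarrow> 'b) \<Rightarrow> ('e \<Rightarrow> 'f) \<Rightarrow> bool"
  where "fibre_map E p F q u \<longleftrightarrow> continuous_map E F u \<and> (\<forall>z\<in>topspace E. q (u z) = p z)"

definition fibre_homotopic ::
    "'e topology \<Rightarrow> ('e \<Rightarrow> 'b) \<Rightarrow> 'f topology \<Rightarrow> ('f \<Rightarrow> 'b) \<Rightarrow> ('e \<Rightarrow> 'f) \<Rightarrow> ('e \<Rightarrow> 'f) \<Rightarrow> bool"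
  where "fibre_homotopic E p F q =
    homotopic_with (\<lambda>u. \<forall>z\<in>topspace E. q (u z) = p z) E F"

definition has_fibre_homotopy_inverse ::
    "'e topology \<Rightarrow> ('e \<Rightarrow> 'b) \<Rightarrow> 'f topology \<Rightarrow> ('f \<Rightarrow> 'b) \<Rightarrow> ('e \<Rightarrow> 'f) \<Rightarrow> bool"
  where "has_fibre_homotopy_inverse E p F q u \<longleftrightarrow>
    fibre_map E p F q u \<and>
    (\<exists>v. fibre_map F q E p v \<and>
         fibre_homotopic E p E p (v \<circ> u) id \<and>
         fibre_homotopic F q F q (u \<circ> v) id)"

section \<open>D-spaces\<close>

text \<open>A path is a function on all of \<open>real\<close> that is \<open>undefined\<close> outside the unit interval, so that
  equality of paths is equality on the interval. Operations on paths restrict their result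
  accordingly.\<close>

definition path_space :: "'a topology \<Rightarrow> (real \<Rightarrow> 'a) set"
  where "path_space X = {p \<in> extensional {0..1}. continuous_map unit_interval X p}"

definition path_concat :: "(real \<Rightarrow> 'a) \<Rightarrow> (real \<Rightarrow> 'a) \<Rightarrow> real \<Rightarrow> 'a"
  where "path_concat p q =
    restrict (\<lambda>t. if t \<le> 1/2 then p (2 * t) else q (2 * t - 1)) {0..1}"

definition path_map :: "('a \<Rightarrow> 'b) \<Rightarrow> (real \<Rightarrow> 'a) \<Rightarrow> real \<Rightarrow> 'b"
  where "path_map f p = restrict (f \<circ> p) {0..1}"

definition reparam :: "(real \<Rightarrow> 'a) \<Rightarrow> (real \<Rightarrow> real) \<Rightarrow> real \<Rightarrow> 'a"
  where "reparam p \<phi> = restrict (p \<circ> \<phi>) {0..1}"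

text \<open>These need not fix the end points, so d-paths are closed under passing to subpaths.\<close>

definition reparametrizations :: "(real \<Rightarrow> real) set"
  where "reparametrizations =
    {\<phi>. continuous_map unit_interval unit_interval \<phi> \<and> mono_on {0..1} \<phi>}"

record 'a dspace =
  dtop :: "'a topology"
  dpaths :: "(real \<Rightarrow> 'a) set"

definition is_dspace :: "'a dspace \<Rightarrow> bool"
  where "is_dspace X \<longleftrightarrow>
    dpaths X \<subseteq> path_space (dtop X) \<and>
    (\<forall>x\<in>topspace (dtop X). restrict (\<lambda>_. x) {0..1} \<in> dpaths X) \<and>
    (\<forall>p\<in>dpaths X. \<forall>q\<in>dpaths X. p 1 = q 0 \<longrightarrow> path_concat p q \<in> dpaths X) \<and>
    (\<forall>p\<in>dpaths X. \<forall>\<phi>\<in>reparametrizations. reparam p \<phi> \<in> dpaths X)"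

definition dmap :: "'a dspace \<Rightarrow> 'b dspace \<Rightarrow> ('a \<Rightarrow> 'b) \<Rightarrow> bool"
  where "dmap X Y f \<longleftrightarrow>
    continuous_map (dtop X) (dtop Y) f \<and> (\<forall>p\<in>dpaths X. path_map f p \<in> dpaths Y)"

definition dprod :: "'a dspace \<Rightarrow> 'b dspace \<Rightarrow> ('a \<times> 'b) dspace"
  where "dprod X Y =
    \<lparr>dtop = prod_topology (dtop X) (dtop Y),
     dpaths = {p \<in> path_space (prod_topology (dtop X) (dtop Y)).
       path_map fst p \<in> dpaths X \<and> path_map snd p \<in> dpaths Y}\<rparr>"

definition directed_interval :: "real dspace"
  where "directed_interval =
    \<lparr>dtop = unit_interval, dpaths = {p \<in> path_space unit_interval. mono_on {0..1} p}\<rparr>"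

definition neutral_interval :: "real dspace"
  where "neutral_interval =
    \<lparr>dtop = unit_interval, dpaths = {restrict (\<lambda>_. x) {0..1} | x. x \<in> {0..1}}\<rparr>"

definition dpath_topology :: "'a dspace \<Rightarrow> (real \<Rightarrow> 'a) topology"
  where "dpath_topology X =
    subtopology (compact_open_topology unit_interval (dtop X)) (dpaths X)"

definition dreach :: "'a dspace \<Rightarrow> ('a \<times> 'a) topology"
  where "dreach X =
    subtopology (prod_topology (dtop X) (dtop X))
      {(x, y). \<exists>p\<in>dpaths X. p 0 = x \<and> p 1 = y}"

section \<open>Trace spaces\<close>

definition reparam_step :: "'a dspace \<Rightarrow> (real \<Rightarrow> 'a) \<Rightarrow> (real \<Rightarrow> 'a) \<Rightarrow> bool"
  where "reparam_step X p q \<longleftrightarrow>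
    p \<in> dpaths X \<and> (\<exists>\<phi>\<in>reparametrizations. \<phi> 0 = 0 \<and> \<phi> 1 = 1 \<and> q = reparam p \<phi>)"

definition trace_rel :: "'a dspace \<Rightarrow> ((real \<Rightarrow> 'a) \<times> (real \<Rightarrow> 'a)) set"
  where "trace_rel X =
    {(p, q). p \<in> dpaths X \<and> q \<in> dpaths X \<and> equivclp (reparam_step X) p q}"

definition trace_space :: "'a dspace \<Rightarrow> (real \<Rightarrow> 'a) set topology"
  where "trace_space X = quotient_topology (dpath_topology X) (\<lambda>p. trace_rel X `` {p})"

text \<open>All representatives of a trace have the same end points, and \<open>dmap\<close>s respect \<open>trace_rel\<close>;
  so the image below is a singleton, respectively a single equivalence class.\<close>

definition endpoints :: "(real \<Rightarrow> 'a) set \<Rightarrow> 'a \<times> 'a"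
  where "endpoints \<sigma> = the_elem ((\<lambda>p. (p 0, p 1)) ` \<sigma>)"

definition trace_map :: "'b dspace \<Rightarrow> ('a \<Rightarrow> 'b) \<Rightarrow> (real \<Rightarrow> 'a) set \<Rightarrow> (real \<Rightarrow> 'b) set"
  where "trace_map Y f \<sigma> = trace_rel Y `` (path_map f ` \<sigma>)"

definition trace_fibre :: "'a dspace \<Rightarrow> 'a \<times> 'a \<Rightarrow> (real \<Rightarrow> 'a) set topology"
  where "trace_fibre X z = subtopology (trace_space X) {\<sigma>. endpoints \<sigma> = z}"

section \<open>Path space preserving maps and homotopies\<close>

definition psp :: "'a dspace \<Rightarrow> 'b dspace \<Rightarrow> ('a \<Rightarrow> 'b) \<Rightarrow> bool"
  where "psp X Y f \<longleftrightarrow>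
    dmap X Y f \<and>
    (\<forall>(x1, x2)\<in>topspace (dreach X).
      weak_homotopy_equivalence (trace_fibre X (x1, x2)) (trace_fibre Y (f x1, f x2))
        (trace_map Y f))"

definition d_homotopy :: "'a dspace \<Rightarrow> ('a \<times> real \<Rightarrow> 'a) \<Rightarrow> bool"
  where "d_homotopy X H \<longleftrightarrow> dmap (dprod X directed_interval) X H"

definition neutral_d_homotopy :: "'a dspace \<Rightarrow> ('a \<times> real \<Rightarrow> 'a) \<Rightarrow> bool"
  where "neutral_d_homotopy X H \<longleftrightarrow> dmap (dprod X neutral_interval) X H"

definition psp_homotopy :: "'a dspace \<Rightarrow> ('a \<times> real \<Rightarrow> 'a) \<Rightarrow> bool"
  where "psp_homotopy X H \<longleftrightarrow> (\<forall>t\<in>{0..1}. psp X X (\<lambda>x. H (x, t)))"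

text \<open>The pullback of \<open>endpoints\<close> along \<open>((x1, x2), t) \<mapsto> (H (x1, t), H (x2, t))\<close>, whose projection
  to the base is \<open>fst\<close>.\<close>

definition homotopy_pullback ::
    "'a dspace \<Rightarrow> ('a \<times> real \<Rightarrow> 'a) \<Rightarrow> ((('a \<times> 'a) \<times> real) \<times> (real \<Rightarrow> 'a) set) topology"
  where "homotopy_pullback X H =
    subtopology (prod_topology (prod_topology (dreach X) unit_interval) (trace_space X))
      {(((x1, x2), t), \<sigma>). endpoints \<sigma> = (H (x1, t), H (x2, t))}"

definition coherently_psp :: "'a dspace \<Rightarrow> ('a \<times> real \<Rightarrow> 'a) \<Rightarrow> bool"
  where "coherently_psp X H \<longleftrightarrow>
    psp_homotopy X H \<and>
    has_fibre_homotopy_inverse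
      (prod_topology (trace_space X) unit_interval) (\<lambda>(\<sigma>, t). (endpoints \<sigma>, t))
      (homotopy_pullback X H) fst
      (\<lambda>(\<sigma>, t). ((endpoints \<sigma>, t), trace_map X (\<lambda>x. H (x, t)) \<sigma>))"

section \<open>Coherent directed homotopy equivalences\<close>

datatype direction = Plus | Minus | Neutral

fun directed_homotopy_between ::
    "direction \<Rightarrow> 'a dspace \<Rightarrow> ('a \<Rightarrow> 'a) \<Rightarrow> ('a \<times> real \<Rightarrow> 'a) \<Rightarrow> bool"
  where
    "directed_homotopy_between Plus X f H \<longleftrightarrow>
      d_homotopy X H \<and> (\<forall>x\<in>topspace (dtop X). H (x, 0) = x \<and> H (x, 1) = f x)"
  | "directed_homotopy_between Minus X f H \<longleftrightarrow>
      d_homotopy X H \<and> (\<forall>x\<in>topspace (dtop X). H (x, 0) = f x \<and> H (x, 1) = x)"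
  | "directed_homotopy_between Neutral X f H \<longleftrightarrow>
      neutral_d_homotopy X H \<and> (\<forall>x\<in>topspace (dtop X). H (x, 0) = x \<and> H (x, 1) = f x)"

definition coherently_inessential :: "direction \<Rightarrow> 'a dspace \<Rightarrow> ('a \<Rightarrow> 'a) \<Rightarrow> bool"
  where "coherently_inessential \<alpha> X f \<longleftrightarrow>
    dmap X X f \<and> (\<exists>H. directed_homotopy_between \<alpha> X f H \<and> coherently_psp X H)"

definition coherently_rather_inessential :: "direction \<Rightarrow> 'a dspace \<Rightarrow> ('a \<Rightarrow> 'a) \<Rightarrow> bool"
  where "coherently_rather_inessential \<alpha> X h \<longleftrightarrow>
    dmap X X h \<and>
    (\<exists>g. coherently_inessential \<alpha> X g \<and> coherently_inessential \<alpha> X (h \<circ> g))"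

definition coherent_directed_homotopy_equivalence ::
    "direction \<Rightarrow> 'a dspace \<Rightarrow> 'b dspace \<Rightarrow> ('a \<Rightarrow> 'b) \<Rightarrow> bool"
  where "coherent_directed_homotopy_equivalence \<alpha> X Y f \<longleftrightarrow>
    dmap X Y f \<and>
    (\<exists>g. dmap Y X g \<and>
         coherently_rather_inessential \<alpha> X (g \<circ> f) \<and>
         coherently_rather_inessential \<alpha> Y (f \<circ> g))"

section \<open>Directed topological complexity\<close>

definition has_motion_planner :: "'a dspace \<Rightarrow> nat \<Rightarrow> bool"
  where "has_motion_planner X n \<longleftrightarrow>
    (\<exists>s A. (\<forall>z\<in>topspace (dreach X). s z \<in> topspace (trace_space X) \<and> endpoints (s z) = z) \<and>
           disjoint_family_on A {1..n} \<and>
           (\<Union>i\<in>{1..n}. A i) = topspace (dreach X) \<and>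
           (\<forall>i\<in>{1..n}. continuous_map (subtopology (dreach X) (A i)) (trace_space X) s))"

text \<open>The value is \<open>\<infinity>\<close> if there is no such number.\<close>

definition directed_TC :: "'a dspace \<Rightarrow> enat"
  where "directed_TC X = (INF n\<in>{n. has_motion_planner X n}. enat n)"

end

theory Submission
  imports Defs
begin

text \<open>
  Directed topological complexity is monotone along a pair of d-maps \<open>\<phi> : X \<rightarrow> Y\<close>, \<open>g : Y \<rightarrow> X\<close>
  whose composite \<open>g \<circ> \<phi>\<close> is a stage \<open>H\<^sub>t\<close> of a coherently psp homotopy on \<open>X\<close>: a motion planner
  \<open>s\<close> on \<open>Y\<close> can be transported to \<open>X\<close>. For a reachable pair \<open>z = (x1, x2)\<close> of \<open>X\<close>, plan in \<open>Y\<close>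
  from \<open>\<phi> x1\<close> to \<open>\<phi> x2\<close> and push the result forward along \<open>g\<close>. This is a trace from \<open>H\<^sub>t x1\<close> to
  \<open>H\<^sub>t x2\<close>, that is, a point of the homotopy pullback over \<open>(z, t)\<close>. The fibre homotopy inverse in the
  definition of a coherently psp homotopy is a map over \<open>dreach X \<times> I\<close>, so it turns this
  trace into a trace with the prescribed end points \<open>x1\<close> and \<open>x2\<close>, and it does so continuously in
  all data. The new planner is therefore continuous on the preimage under \<open>\<phi> \<times> \<phi>\<close> of every set
  on which \<open>s\<close> is continuous (lemma \<open>motion_planner_transport\<close>).

  For a coherent directed homotopy equivalence \<open>f\<close> with inverse \<open>g\<close> there is a d-map \<open>k\<close> on \<open>X\<close> such
  that \<open>g \<circ> f \<circ> k\<close> is coherently inessential; the transport applies to the pair \<open>f \<circ> k\<close>, \<open>g\<close>. The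
  situation is symmetric, hence \<open>X\<close> and \<open>Y\<close> have motion planners of the same sizes. The rest is
  the functoriality of trace spaces: a d-map induces a continuous map of trace spaces over
  the map of end points.
\<close>

section \<open>Traces and their end points\<close>

text \<open>The choice \<open>K = {}\<close> of the compact set shows that the subbasic sets cover all paths.\<close>

lemma topspace_compact_open_unit_interval:
  "topspace (compact_open_topology unit_interval X) = path_space X"
proof -
  have "{f \<in> extensional {0..1}. continuous_map unit_interval X f \<and> f ` {} \<subseteq> {}}
      \<in> {{f \<in> extensional (topspace unit_interval). continuous_map unit_interval X f \<and> f ` K \<subseteq> U}
          | K U. compactin unit_interval K \<and> openin X U}"
    by (auto intro!: exI[of _ "{}"])
  then show ?thesis
    by (auto simp: compact_open_topology_def topology_generated_by_topspace path_space_def)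
qed

lemma topspace_dpath_topology:
  assumes "is_dspace X"
  shows "topspace (dpath_topology X) = dpaths X"
  using assms
  by (auto simp: dpath_topology_def topspace_compact_open_unit_interval is_dspace_def)

lemma topspace_trace_space:
  assumes "is_dspace X"
  shows "topspace (trace_space X) = (\<lambda>p. trace_rel X `` {p}) ` dpaths X"
  unfolding trace_space_def topspace_dpath_topology[OF assms, symmetric]
  by (rule quotient_imp_surjective_map[OF quotient_map_quotient_topology, symmetric])

lemma equiv_trace_rel: "equiv (dpaths X) (trace_rel X)"
proof (rule equivI)
  show "trace_rel X \<subseteq> dpaths X \<times> dpaths X"
    by (auto simp: trace_rel_def)
  show "refl_on (dpaths X) (trace_rel X)"
    by (auto simp: trace_rel_def refl_on_def)
  show "sym (trace_rel X)"
    by (auto simp: trace_rel_def sym_def equivclp_sym)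
  show "trans (trace_rel X)"
    unfolding trace_rel_def trans_def by (blast intro: equivclp_trans)
qed

lemma reparam_step_endpoints:
  assumes "reparam_step X p q"
  shows "p 0 = q 0" "p 1 = q 1"
  using assms by (auto simp: reparam_step_def reparam_def)

lemma trace_rel_endpoints:
  assumes "(p, q) \<in> trace_rel X"
  shows "q 0 = p 0 \<and> q 1 = p 1"
proof -
  have "equivclp (reparam_step X) p q"
    using assms by (simp add: trace_rel_def)
  then show ?thesis
    by (induction rule: equivclp_induct) (auto dest: reparam_step_endpoints)
qed

lemma endpoints_trace:
  assumes "p \<in> dpaths X"
  shows "endpoints (trace_rel X `` {p}) = (p 0, p 1)"
proof -
  have "p \<in> trace_rel X `` {p}"
    using equiv_class_self[OF equiv_trace_rel assms] .
  then have "(\<lambda>q. (q 0, q 1)) ` (trace_rel X `` {p}) = {(p 0, p 1)}"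
    by (force dest: trace_rel_endpoints)
  then show ?thesis
    by (simp add: endpoints_def)
qed

section \<open>Functoriality of trace spaces\<close>

lemma dmap_compose:
  assumes "dmap X Y f" and "dmap Y Z g"
  shows "dmap X Z (g \<circ> f)"
proof -
  have "path_map (g \<circ> f) p = path_map g (path_map f p)" for p
    by (auto simp: path_map_def)
  with assms show ?thesis
    by (auto simp: dmap_def intro: continuous_map_compose)
qed

text \<open>Postcomposition with a map commutes with reparametrization.\<close>

lemma reparam_step_path_map:
  assumes "dmap X Y f" and "reparam_step X p q"
  shows "reparam_step Y (path_map f p) (path_map f q)"
proof -
  obtain \<phi> where \<phi>: "\<phi> \<in> reparametrizations" "\<phi> 0 = 0" "\<phi> 1 = 1" "q = reparam p \<phi>"
    and p: "p \<in> dpaths X"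
    using assms(2) by (auto simp: reparam_step_def)
  have "\<phi> t \<in> {0..1}" if "t \<in> {0..1}" for t
    using \<phi>(1) that by (auto simp: reparametrizations_def continuous_map_def Pi_iff)
  then have "path_map f q = reparam (path_map f p) \<phi>"
    unfolding \<phi>(4) by (fastforce simp: path_map_def reparam_def restrict_def)
  with \<phi> p assms(1) show ?thesis
    by (auto simp: reparam_step_def dmap_def)
qed

lemma trace_rel_path_map:
  assumes f: "dmap X Y f" and pq: "(p, q) \<in> trace_rel X"
  shows "(path_map f p, path_map f q) \<in> trace_rel Y"
proof -
  have "equivclp (reparam_step X) p q"
    using pq by (simp add: trace_rel_def)
  then have "equivclp (reparam_step Y) (path_map f p) (path_map f q)"
  proof (induction rule: equivclp_induct)
    case (step y z)
    then have "equivclp (reparam_step Y) (path_map f y) (path_map f z)"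
      by (metis reparam_step_path_map[OF f] r_into_equivclp equivclp_sym)
    with step.IH show ?case
      by (rule equivclp_trans)
  qed simp
  with pq f show ?thesis
    by (auto simp: trace_rel_def dmap_def)
qed

lemma trace_map_trace:
  assumes f: "dmap X Y f" and p: "p \<in> dpaths X"
  shows "trace_map Y f (trace_rel X `` {p}) = trace_rel Y `` {path_map f p}"
proof -
  have "trace_rel Y `` {path_map f q} = trace_rel Y `` {path_map f p}"
    if "(p, q) \<in> trace_rel X" for q
    using equiv_class_eq[OF equiv_trace_rel trace_rel_path_map[OF f that]] by simp
  moreover have "p \<in> trace_rel X `` {p}"
    using equiv_class_self[OF equiv_trace_rel p] .
  ultimately show ?thesis
    unfolding trace_map_def by blast
qed

lemma endpoints_trace_map:
  assumes "is_dspace X" and f: "dmap X Y f"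
    and \<sigma>: "\<sigma> \<in> topspace (trace_space X)"
  shows "endpoints (trace_map Y f \<sigma>) = map_prod f f (endpoints \<sigma>)"
proof -
  obtain p where p: "p \<in> dpaths X" "\<sigma> = trace_rel X `` {p}"
    using \<sigma> by (auto simp: topspace_trace_space[OF assms(1)])
  moreover from p f have "path_map f p \<in> dpaths Y"
    by (auto simp: dmap_def)
  moreover have "path_map f p 0 = f (p 0)" "path_map f p 1 = f (p 1)"
    by (auto simp: path_map_def)
  ultimately show ?thesis
    by (simp only: trace_map_trace[OF f] endpoints_trace map_prod_simp)
qed

text \<open>Postcomposition with \<open>f\<close> pulls the subbasic set of \<open>K\<close> and \<open>U\<close> back to the subbasic set of
  \<open>K\<close> and the preimage of \<open>U\<close>.\<close>

lemma continuous_map_path_map: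
  assumes X: "is_dspace X" and Y: "is_dspace Y" and f: "dmap X Y f"
  shows "continuous_map (dpath_topology X) (dpath_topology Y) (path_map f)"
proof -
  have cont: "continuous_map (dtop X) (dtop Y) f"
    and dp: "p \<in> dpaths X \<Longrightarrow> path_map f p \<in> dpaths Y" for p
    using f by (auto simp: dmap_def)
  have paths: "p \<in> dpaths X \<Longrightarrow> p \<in> path_space (dtop X)" for p
    using X by (auto simp: is_dspace_def)
  have paths': "p \<in> dpaths Y \<Longrightarrow> p \<in> path_space (dtop Y)" for p
    using Y by (auto simp: is_dspace_def)
  have "continuous_map (dpath_topology X) (compact_open_topology unit_interval (dtop Y)) (path_map f)"
    unfolding compact_open_topology_def
  proof (rule continuous_on_generated_topo)
    fix W
    assume "W \<in> {{h \<in> extensional (topspace unit_interval).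
        continuous_map unit_interval (dtop Y) h \<and> h ` K \<subseteq> U}
        | K U. compactin unit_interval K \<and> openin (dtop Y) U}"
    then obtain K U where W: "W = {h \<in> path_space (dtop Y). h ` K \<subseteq> U}"
      and K: "compactin unit_interval K" and U: "openin (dtop Y) U"
      by (auto simp: path_space_def)
    define U' where "U' = {x \<in> topspace (dtop X). f x \<in> U}"
    have U': "openin (dtop X) U'"
      unfolding U'_def by (rule openin_continuous_map_preimage[OF cont U])
    have K01: "K \<subseteq> {0..1}"
      using K by (auto simp: compactin_def)
    define V where "V = {p \<in> path_space (dtop X). p ` K \<subseteq> U'}"
    have "openin (compact_open_topology unit_interval (dtop X)) V"
      unfolding compact_open_topology_def V_def path_space_def
      using K U' by (intro topology_generated_by_Basis) auto
    moreover have "path_map f -` W \<inter> topspace (dpath_topology X) = V \<inter> dpaths X"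
    proof -
      have "path_map f p ` K \<subseteq> U \<longleftrightarrow> p ` K \<subseteq> U'" if "p \<in> dpaths X" for p
      proof -
        have "p t \<in> topspace (dtop X)" if "t \<in> K" for t
          using paths[OF \<open>p \<in> dpaths X\<close>] K01 that
          by (auto simp: path_space_def continuous_map_def Pi_iff)
        then show ?thesis
          using K01 by (auto simp: U'_def path_map_def image_subset_iff subset_iff)
      qed
      then show ?thesis
        using dp paths paths' by (auto simp: W V_def topspace_dpath_topology[OF X])
    qed
    ultimately show "openin (dpath_topology X) (path_map f -` W \<inter> topspace (dpath_topology X))"
      unfolding dpath_topology_def openin_subtopology by metis
  next
    have "path_map f ` topspace (dpath_topology X)
        \<subseteq> topspace (compact_open_topology unit_interval (dtop Y))"
      using dp paths' by (auto simp: topspace_dpath_topology[OF X] topspace_compact_open_unit_interval)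
    then show "path_map f ` topspace (dpath_topology X) \<subseteq>
      \<Union> {{h \<in> extensional (topspace unit_interval).
        continuous_map unit_interval (dtop Y) h \<and> h ` K \<subseteq> U}
        | K U. compactin unit_interval K \<and> openin (dtop Y) U}"
      by (simp only: compact_open_topology_def topology_generated_by_topspace)
  qed
  then show ?thesis
    using dp topspace_dpath_topology[OF X]
    by (auto simp: dpath_topology_def[of Y] continuous_map_in_subtopology)
qed

lemma continuous_map_trace_map:
  assumes X: "is_dspace X" and Y: "is_dspace Y" and f: "dmap X Y f"
  shows "continuous_map (trace_space X) (trace_space Y) (trace_map Y f)"
proof -
  have qX: "quotient_map (dpath_topology X) (trace_space X) (\<lambda>p. trace_rel X `` {p})"
    and qY: "quotient_map (dpath_topology Y) (trace_space Y) (\<lambda>p. trace_rel Y `` {p})"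
    unfolding trace_space_def by (rule quotient_map_quotient_topology)+
  have "continuous_map (dpath_topology X) (trace_space Y)
      ((\<lambda>p. trace_rel Y `` {p}) \<circ> path_map f)"
    using continuous_map_path_map[OF assms] quotient_imp_continuous_map[OF qY]
    by (rule continuous_map_compose)
  then have "continuous_map (dpath_topology X) (trace_space Y)
      (trace_map Y f \<circ> (\<lambda>p. trace_rel X `` {p}))"
    by (rule continuous_map_eq) (simp add: topspace_dpath_topology[OF X] trace_map_trace[OF f])
  then show ?thesis
    using continuous_compose_quotient_map_eq[OF qX] by blast
qed

lemma continuous_map_dreach:
  assumes f: "dmap X Y f"
  shows "continuous_map (dreach X) (dreach Y) (map_prod f f)"
proof -
  have "continuous_map (dtop X) (dtop Y) f"
    using f by (simp add: dmap_def)
  then have "continuous_map (prod_topology (dtop X) (dtop X)) (prod_topology (dtop Y) (dtop Y))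
      (map_prod f f)"
    by (auto simp: map_prod_def case_prod_unfold continuous_map_pairwise o_def
             intro: continuous_map_compose[unfolded o_def] continuous_map_fst continuous_map_snd)
  moreover have "\<exists>q\<in>dpaths Y. q 0 = f (p 0) \<and> q 1 = f (p 1)" if "p \<in> dpaths X" for p
    using f that by (intro bexI[of _ "path_map f p"]) (auto simp: dmap_def path_map_def)
  ultimately show ?thesis
    unfolding dreach_def
    by (auto simp: continuous_map_in_subtopology intro: continuous_map_from_subtopology)
qed

section \<open>Transport of motion planners\<close>

text \<open>The fibre homotopy inverse \<open>v\<close> serves as a correction of end points: over the slice at time \<open>t\<close>
  it turns traces from \<open>H\<^sub>t x1\<close> to \<open>H\<^sub>t x2\<close> into traces from \<open>x1\<close> to \<open>x2\<close>, continuously in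
  the trace and in \<open>(x1, x2)\<close>.\<close>

lemma motion_planner_transport:
  assumes X: "is_dspace X" and Y: "is_dspace Y"
    and \<phi>: "dmap X Y \<phi>" and g: "dmap Y X g"
    and H: "coherently_psp X H"
    and t: "t \<in> {0..1}" and Ht: "\<And>x. x \<in> topspace (dtop X) \<Longrightarrow> H (x, t) = g (\<phi> x)"
    and planner: "has_motion_planner Y n"
  shows "has_motion_planner X n"
proof -
  obtain s A where
    s: "\<And>z. z \<in> topspace (dreach Y) \<Longrightarrow> s z \<in> topspace (trace_space Y) \<and> endpoints (s z) = z"
    and disj: "disjoint_family_on A {1..n}"
    and cover: "(\<Union>i\<in>{1..n}. A i) = topspace (dreach Y)"
    and cont: "\<And>i. i \<in> {1..n} \<Longrightarrow>
      continuous_map (subtopology (dreach Y) (A i)) (trace_space Y) s"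
    using planner unfolding has_motion_planner_def by blast
  obtain v where v: "fibre_map (homotopy_pullback X H) fst
      (prod_topology (trace_space X) unit_interval) (\<lambda>(\<sigma>, t). (endpoints \<sigma>, t)) v"
    using H unfolding coherently_psp_def has_fibre_homotopy_inverse_def by blast
  have v_cont: "continuous_map (homotopy_pullback X H)
      (prod_topology (trace_space X) unit_interval) v"
    and v_over: "\<And>w. w \<in> topspace (homotopy_pullback X H) \<Longrightarrow>
      endpoints (fst (v w)) = fst (fst w)"
    using v by (simp_all add: fibre_map_def case_prod_unfold prod_eq_iff)
  define \<Phi> where "\<Phi> = map_prod \<phi> \<phi>"
  define w where "w z = ((z, t), trace_map X g (s (\<Phi> z)))" for z
  define s' where "s' z = fst (v (w z))" for z
  define A' where "A' i = {z \<in> topspace (dreach X). \<Phi> z \<in> A i}" for i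
  have \<Phi>_cont: "continuous_map (dreach X) (dreach Y) \<Phi>"
    unfolding \<Phi>_def by (rule continuous_map_dreach[OF \<phi>])
  have \<Phi>_in: "\<Phi> z \<in> topspace (dreach Y)" if "z \<in> topspace (dreach X)" for z
    using \<Phi>_cont that by (auto simp: continuous_map_def Pi_iff)
  have g_cont: "continuous_map (trace_space Y) (trace_space X) (trace_map X g)"
    by (rule continuous_map_trace_map[OF Y X g])
  have over: "endpoints (trace_map X g (s (\<Phi> z))) = (H (fst z, t), H (snd z, t))"
    and w_in: "w z \<in> topspace (homotopy_pullback X H)"
    if z: "z \<in> topspace (dreach X)" for z
  proof -
    have sz: "s (\<Phi> z) \<in> topspace (trace_space Y)" "endpoints (s (\<Phi> z)) = \<Phi> z"
      using s[OF \<Phi>_in[OF z]] by auto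
    have "fst z \<in> topspace (dtop X)" "snd z \<in> topspace (dtop X)"
      using z by (auto simp: dreach_def)
    then show *: "endpoints (trace_map X g (s (\<Phi> z))) = (H (fst z, t), H (snd z, t))"
      using endpoints_trace_map[OF Y g sz(1)] sz(2) Ht
      by (simp add: \<Phi>_def map_prod_def case_prod_unfold)
    have "trace_map X g (s (\<Phi> z)) \<in> topspace (trace_space X)"
      using g_cont sz(1) by (auto simp: continuous_map_def Pi_iff)
    then show "w z \<in> topspace (homotopy_pullback X H)"
      using * z t by (simp add: w_def homotopy_pullback_def case_prod_unfold)
  qed
  have s'_section: "s' z \<in> topspace (trace_space X) \<and> endpoints (s' z) = z"
    if z: "z \<in> topspace (dreach X)" for z
  proof -
    have "v (w z) \<in> topspace (prod_topology (trace_space X) unit_interval)"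
      using v_cont w_in[OF z] by (auto simp: continuous_map_def Pi_iff)
    then show ?thesis
      using v_over[OF w_in[OF z]] by (auto simp: s'_def w_def)
  qed
  have s'_cont: "continuous_map (subtopology (dreach X) (A' i)) (trace_space X) s'"
    if i: "i \<in> {1..n}" for i
  proof -
    let ?D = "subtopology (dreach X) (A' i)"
    have "continuous_map ?D (subtopology (dreach Y) (A i)) \<Phi>"
      using \<Phi>_cont
      by (auto simp: continuous_map_in_subtopology A'_def intro: continuous_map_from_subtopology)
    from continuous_map_compose[OF continuous_map_compose[OF this cont[OF i]] g_cont]
    have "continuous_map ?D (trace_space X) (\<lambda>z. trace_map X g (s (\<Phi> z)))"
      by (simp add: o_def)
    moreover have "continuous_map ?D unit_interval (\<lambda>z. t)"
      using t by simp
    moreover have "continuous_map ?D (dreach X) (\<lambda>z. z)"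
      by (rule continuous_map_from_subtopology) simp
    ultimately have "continuous_map ?D
        (prod_topology (prod_topology (dreach X) unit_interval) (trace_space X)) w"
      by (simp add: w_def continuous_map_pairwise o_def)
    then have "continuous_map ?D (homotopy_pullback X H) w"
      using over unfolding homotopy_pullback_def continuous_map_in_subtopology
      by (simp add: w_def case_prod_unfold Pi_iff)
    from continuous_map_compose[OF continuous_map_compose[OF this v_cont] continuous_map_fst]
    show ?thesis
      by (simp add: s'_def[abs_def] o_def)
  qed
  have "disjoint_family_on A' {1..n}"
    using disj by (fastforce simp: disjoint_family_on_def A'_def)
  moreover have "(\<Union>i\<in>{1..n}. A' i) = topspace (dreach X)"
    using \<Phi>_in cover by (fastforce simp: A'_def)
  ultimately show ?thesis
    unfolding has_motion_planner_def
    by (intro exI[of _ s'] exI[of _ A'] conjI ballI s'_section s'_cont)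
qed

lemma coherently_inessential_end:
  assumes "coherently_inessential \<alpha> X h"
  obtains H t where "coherently_psp X H" "t \<in> {0..1}"
    "\<And>x. x \<in> topspace (dtop X) \<Longrightarrow> H (x, t) = h x"
proof -
  obtain H where H: "directed_homotopy_between \<alpha> X h H" "coherently_psp X H"
    using assms by (auto simp: coherently_inessential_def)
  show thesis
  proof (cases \<alpha>)
    case Minus
    with H show ?thesis by (intro that[of H 0]) auto
  qed (use H in \<open>auto intro!: that[of H 1]\<close>)
qed

text \<open>The composite \<open>g \<circ> f\<close> itself need not be a stage of a coherently psp homotopy, but some
  \<open>g \<circ> f \<circ> k\<close> is; therefore the transport is along \<open>f \<circ> k\<close> instead of \<open>f\<close>.\<close>

lemma motion_planner_of_rather_inessential:
  assumes X: "is_dspace X" and Y: "is_dspace Y"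
    and f: "dmap X Y f" and g: "dmap Y X g"
    and gf: "coherently_rather_inessential \<alpha> X (g \<circ> f)"
    and planner: "has_motion_planner Y n"
  shows "has_motion_planner X n"
proof -
  obtain k where k: "coherently_inessential \<alpha> X k" "coherently_inessential \<alpha> X (g \<circ> f \<circ> k)"
    using gf by (auto simp: coherently_rather_inessential_def)
  obtain H t where H: "coherently_psp X H" "t \<in> {0..1}"
    "\<And>x. x \<in> topspace (dtop X) \<Longrightarrow> H (x, t) = (g \<circ> f \<circ> k) x"
    using coherently_inessential_end[OF k(2)] by blast
  have "dmap X X k"
    using k(1) by (simp add: coherently_inessential_def)
  then have "dmap X Y (f \<circ> k)"
    using f by (rule dmap_compose)
  then show ?thesis
    by (rule motion_planner_transport[OF X Y _ g H(1,2) _ planner]) (simp add: H(3))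
qed

theorem proposition4p3:
  fixes X :: "'a dspace" and Y :: "'b dspace" and \<alpha> :: direction
  assumes "is_dspace X" and "is_dspace Y"
    and "ENR_space (dtop X)" and "ENR_space (dtop Y)"
    and "\<exists>f. coherent_directed_homotopy_equivalence \<alpha> X Y f"
  shows "directed_TC X = directed_TC Y"
proof -
  obtain f g where fg: "dmap X Y f" "dmap Y X g"
    "coherently_rather_inessential \<alpha> X (g \<circ> f)" "coherently_rather_inessential \<alpha> Y (f \<circ> g)"
    using assms(5) by (auto simp: coherent_directed_homotopy_equivalence_def)
  have "has_motion_planner X n \<longleftrightarrow> has_motion_planner Y n" for n
    using motion_planner_of_rather_inessential[OF assms(1,2) fg(1,2,3)]
      motion_planner_of_rather_inessential[OF assms(2,1) fg(2,1,4)] by blast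
  then show ?thesis
    by (simp add: directed_TC_def)
qed

end
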